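(* Let $\alpha$ be an expansive automorphism of a totally disconnected, locally compact group $G$. Then the following holds: (a) $G$ is metrizable and has an $\alpha$-stable, $\sigma$-compact open subgroup; (b) $V_{--}=U_\alpha$ and $V_{++}=U_{\alpha^{-1}}$ for each compact open subgroup $V\subseteq G$ such that $V_0=\{1\}$; (c) $G$ has a compact open subgroup $V$ such that $V=V_+V_-$ and $V_0=\{1\}$; (d) $U_\alpha U_{\alpha^{-1}}$ is open in $G$; (e) $\alpha|_H$ is expansive, for each $\alpha$-stable subgroup $H\subseteq G$.
   Context: All topological groups are Hausdorff. An automorphism of a topological group is a group automorphism $\alpha$ with $\alpha$ and $\alpha^{-1}$ continuous; a subset $H$ is $\alpha$-stable if $\alpha(H)=H$. An automorphism $\alpha$ of a topological group $G$ is expansive if $\bigcap_{n\in\mathbb{Z}}\alpha^n(U)=\{1\}$ for some identity neighbourhood $U\subseteq G$. Contraction groups: $U_\alpha:=\{g\in G\colon \alpha^n(g)\to 1\text{ as }n\to\infty\}$, and $U_{\alpha^{-1}}$ likewise with $\alpha^{-1}$ in place of $\alpha$; $U_\alpha U_{\alpha^{-1}}=\{xy\colon x\in U_\alpha,\ y\in U_{\alpha^{-1}}\}$. For a compact open subgroup $V\subseteq G$: $V_+:=\bigcap_{n=0}^\infty\alpha^n(V)$, $V_-:=\bigcap_{n=0}^\infty\alpha^{-n}(V)$, $V_{++}:=\bigcup_{n\ge0}\alpha^n(V_+)$, $V_{--}:=\bigcup_{n\ge0}\alpha^{-n}(V_-)$ and $V_0:=V_+\cap V_-=\bigcap_{n\in\mathbb{Z}}\alpha^n(V)$.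 *)

theory Defs
  imports "HOL-Analysis.Analysis" "HOL-Algebra.Coset"
begin

text \<open>
  Topological groups are carrier-based: a group \<open>G\<close> with an abstract topology \<open>T\<close> on its carrier.
  A subgroup \<open>H\<close> is then again a topological group, namely \<open>G\<lparr>carrier := H\<rparr>\<close> with
  \<open>subtopology T H\<close>. All topological groups are Hausdorff.
\<close>

locale topological_group = group G
  for G (structure) and T :: "'a topology" +
  assumes topspace_eq_carrier: "topspace T = carrier G"
    and continuous_mult: "continuous_map (prod_topology T T) T (\<lambda>(x, y). x \<otimes> y)"
    and continuous_inv: "continuous_map T T (\<lambda>x. inv x)"
    and Hausdorff: "Hausdorff_space T"

definition totally_disconnected_space :: "'a topology \<Rightarrow> bool" where
  "totally_disconnected_space T \<longleftrightarrow>
     (\<forall>x \<in> topspace T. connected_component_of_set T x = {x})"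

locale tdlc_group = topological_group +
  assumes totally_disconnected: "totally_disconnected_space T"
    and locally_compact: "locally_compact_space T"

definition sigma_compactin :: "'a topology \<Rightarrow> 'a set \<Rightarrow> bool" where
  "sigma_compactin T S \<longleftrightarrow>
     (\<exists>K :: nat \<Rightarrow> 'a set. (\<forall>n. compactin T (K n)) \<and> S = (\<Union>n. K n))"

definition identity_nhd :: "('a, 'b) monoid_scheme \<Rightarrow> 'a topology \<Rightarrow> 'a set \<Rightarrow> bool" where
  "identity_nhd G T U \<longleftrightarrow>
     U \<subseteq> carrier G \<and> (\<exists>W. openin T W \<and> \<one>\<^bsub>G\<^esub> \<in> W \<and> W \<subseteq> U)"

text \<open>
  The inverse of an automorphism is taken relative to the carrier; the values of \<open>\<alpha>\<close> outside
  the carrier are irrelevant.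
\<close>

definition aut_inv :: "('a, 'b) monoid_scheme \<Rightarrow> ('a \<Rightarrow> 'a) \<Rightarrow> 'a \<Rightarrow> 'a" where
  "aut_inv G \<alpha> = inv_into (carrier G) \<alpha>"

definition aut_pow :: "('a, 'b) monoid_scheme \<Rightarrow> ('a \<Rightarrow> 'a) \<Rightarrow> int \<Rightarrow> 'a \<Rightarrow> 'a" where
  "aut_pow G \<alpha> n = (if 0 \<le> n then \<alpha> ^^ nat n else aut_inv G \<alpha> ^^ nat (- n))"

locale topological_automorphism = topological_group +
  fixes \<alpha> :: "'a \<Rightarrow> 'a"
  assumes automorphism: "\<alpha> \<in> iso G G"
    and continuous_aut: "continuous_map T T \<alpha>"
    and continuous_aut_inv: "continuous_map T T (aut_inv G \<alpha>)"

locale expansive_automorphism = topological_automorphism +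
  assumes expansive: "\<exists>U. identity_nhd G T U \<and> (\<Inter>n::int. aut_pow G \<alpha> n ` U) = {\<one>}"

definition contraction_group ::
  "('a, 'b) monoid_scheme \<Rightarrow> 'a topology \<Rightarrow> ('a \<Rightarrow> 'a) \<Rightarrow> 'a set" where
  "contraction_group G T \<alpha> =
     {g \<in> carrier G. limitin T (\<lambda>n. (\<alpha> ^^ n) g) \<one>\<^bsub>G\<^esub> sequentially}"

definition compact_open_subgroup ::
  "('a, 'b) monoid_scheme \<Rightarrow> 'a topology \<Rightarrow> 'a set \<Rightarrow> bool" where
  "compact_open_subgroup G T V \<longleftrightarrow> subgroup V G \<and> compactin T V \<and> openin T V"

definition V_plus :: "('a, 'b) monoid_scheme \<Rightarrow> ('a \<Rightarrow> 'a) \<Rightarrow> 'a set \<Rightarrow> 'a set" where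
  "V_plus G \<alpha> V = (\<Inter>n::nat. aut_pow G \<alpha> (int n) ` V)"

definition V_minus :: "('a, 'b) monoid_scheme \<Rightarrow> ('a \<Rightarrow> 'a) \<Rightarrow> 'a set \<Rightarrow> 'a set" where
  "V_minus G \<alpha> V = (\<Inter>n::nat. aut_pow G \<alpha> (- int n) ` V)"

definition V_plusplus :: "('a, 'b) monoid_scheme \<Rightarrow> ('a \<Rightarrow> 'a) \<Rightarrow> 'a set \<Rightarrow> 'a set" where
  "V_plusplus G \<alpha> V = (\<Union>n::nat. aut_pow G \<alpha> (int n) ` V_plus G \<alpha> V)"

definition V_minusminus :: "('a, 'b) monoid_scheme \<Rightarrow> ('a \<Rightarrow> 'a) \<Rightarrow> 'a set \<Rightarrow> 'a set" where
  "V_minusminus G \<alpha> V = (\<Union>n::nat. aut_pow G \<alpha> (- int n) ` V_minus G \<alpha> V)"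

definition V_zero :: "('a, 'b) monoid_scheme \<Rightarrow> ('a \<Rightarrow> 'a) \<Rightarrow> 'a set \<Rightarrow> 'a set" where
  "V_zero G \<alpha> V = V_plus G \<alpha> V \<inter> V_minus G \<alpha> V"

lemma V_zero_eq: "V_zero G \<alpha> V = (\<Inter>n::int. aut_pow G \<alpha> n ` V)"
proof (intro Set.set_eqI iffI)
  fix x
  assume x: "x \<in> V_zero G \<alpha> V"
  show "x \<in> (\<Inter>n::int. aut_pow G \<alpha> n ` V)"
  proof (rule INT_I)
    fix n :: int
    show "x \<in> aut_pow G \<alpha> n ` V"
    proof (cases n rule: int_cases2)
      case (nonneg k)
      from x have "x \<in> aut_pow G \<alpha> (int k) ` V"
        unfolding V_zero_def V_plus_def by (metis IntE INT_D UNIV_I)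
      with nonneg show ?thesis by (simp only:)
    next
      case (nonpos k)
      from x have "x \<in> aut_pow G \<alpha> (- int k) ` V"
        unfolding V_zero_def V_minus_def by (metis IntE INT_D UNIV_I)
      with nonpos show ?thesis by (simp only:)
    qed
  qed
next
  fix x
  assume x: "x \<in> (\<Inter>n::int. aut_pow G \<alpha> n ` V)"
  have "x \<in> aut_pow G \<alpha> n ` V" for n :: int
    using x by (rule INT_D) (rule UNIV_I)
  then show "x \<in> V_zero G \<alpha> V"
    unfolding V_zero_def V_plus_def V_minus_def by (intro IntI INT_I)
qed

end

theory Submission
  imports Defs
begin

text \<open>
  By van Dantzig's theorem the expansive neighbourhood contains a compact open subgroup \<open>V\<close>, and
  then \<open>V\<^sub>0 = {1}\<close>. Everything is expressed by the sets of those \<open>x\<close> with \<open>\<alpha>\<^sup>n(x) \<in> V\<close> for all \<open>n\<close> in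
  a given set of integers: by compactness, whenever these sets decrease to \<open>{1}\<close> they eventually lie
  in any given identity neighbourhood. For the windows \<open>[-n, n]\<close> this gives a countable base of open
  subgroups at \<open>1\<close>, hence metrizability; for \<open>[-n, \<infinity>)\<close> it shows that \<open>\<alpha>\<close> contracts \<open>V\<^sub>-\<close>. Passing to
  a finite intersection of translates \<open>\<alpha>\<^sup>k(V)\<close> achieves \<open>V = V\<^sub>+V\<^sub>-\<close>, so that the product of the two
  contraction groups contains \<open>V = V\<^sub>-V\<^sub>+\<close> and is therefore open.
\<close>

section \<open>Nested closed sets in a compact set\<close>

lemma compactin_nest:
  fixes C :: "nat \<Rightarrow> 'a set"
  assumes K: "compactin X K" and clo: "\<And>n. closedin X (C n)" and sub: "\<And>n. C n \<subseteq> K"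
    and ne: "\<And>n. C n \<noteq> {}" and dec: "decseq C"
  shows "(\<Inter>n. C n) \<noteq> {}"
  using compact_space_imp_nest[of "subtopology X K" C] K clo sub ne dec
  by (simp add: closedin_subset_topspace compact_space_subtopology)

text \<open>If every \<open>C n\<close> left \<open>W\<close>, the closed sets
  \<open>C n - W\<close> would be nonempty and decreasing in \<open>K\<close>, hence would share a
  point outside \<open>W\<close>.\<close>

lemma compactin_nest_subset_open:
  fixes C :: "nat \<Rightarrow> 'a set"
  assumes K: "compactin X K" and clo: "\<And>n. closedin X (C n)" and sub: "\<And>n. C n \<subseteq> K"
    and dec: "decseq C" and O: "openin X W" "(\<Inter>n. C n) \<subseteq> W"
  shows "\<exists>n. C n \<subseteq> W"
proof (rule ccontr)
  assume "\<nexists>n. C n \<subseteq> W"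
  then have "(\<Inter>n. C n - W) \<noteq> {}"
    using assms by (intro compactin_nest[OF K]) (auto simp: decseq_def, blast)
  with O show False by auto
qed

section \<open>Topological groups: open cosets, open subgroups and a metrization criterion\<close>

context topological_group
begin

lemma continuous_map_group_mult:
  assumes "continuous_map X T f" "continuous_map X T g"
  shows "continuous_map X T (\<lambda>x. f x \<otimes> g x)"
  using continuous_map_compose[OF _ continuous_mult, of X "\<lambda>x. (f x, g x)"] assms
  by (simp add: continuous_map_paired o_def)

text \<open>The coset is the preimage of \<open>V\<close> under translation by \<open>inv x\<close>,
  which is continuous.\<close>

lemma openin_l_coset:
  assumes V: "openin T V" and x: "x \<in> carrier G"
  shows "openin T (x <# V)"
proof -
  have VG: "V \<subseteq> carrier G"
    using openin_subset[OF V] topspace_eq_carrier by simp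
  have "x <# V = {y \<in> topspace T. inv x \<otimes> y \<in> V}"
    using VG x unfolding l_coset_def topspace_eq_carrier
    by (auto simp: inv_solve_left m_assoc[symmetric] subset_iff intro!: bexI[of _ "inv x \<otimes> _"])
  moreover have "continuous_map T T (\<lambda>y. inv x \<otimes> y)"
    using x by (intro continuous_map_group_mult) (auto simp: topspace_eq_carrier)
  ultimately show ?thesis
    using openin_continuous_map_preimage[OF _ V] by simp
qed

lemma openin_r_coset:
  assumes V: "openin T V" and x: "x \<in> carrier G"
  shows "openin T (V #> x)"
proof -
  have VG: "V \<subseteq> carrier G"
    using openin_subset[OF V] topspace_eq_carrier by simp
  have "V #> x = {y \<in> topspace T. y \<otimes> inv x \<in> V}"
    using VG x unfolding r_coset_def topspace_eq_carrier
    by (auto simp: m_assoc subset_iff intro!: bexI[of _ "_ \<otimes> inv x"])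
  moreover have "continuous_map T T (\<lambda>y. y \<otimes> inv x)"
    using x by (intro continuous_map_group_mult) (auto simp: topspace_eq_carrier)
  ultimately show ?thesis
    using openin_continuous_map_preimage[OF _ V] by simp
qed

lemma openin_set_mult_right:
  assumes V: "openin T V" and S: "S \<subseteq> carrier G"
  shows "openin T (S <#> V)"
proof -
  have "S <#> V = (\<Union>s\<in>S. s <# V)"
    by (auto simp: set_mult_def l_coset_def)
  then show ?thesis
    using openin_l_coset[OF V] S by (auto simp: subset_iff intro!: openin_Union)
qed

lemma openin_set_mult_left:
  assumes V: "openin T V" and S: "S \<subseteq> carrier G"
  shows "openin T (V <#> S)"
proof -
  have "V <#> S = (\<Union>s\<in>S. V #> s)"
    by (auto simp: set_mult_def r_coset_def)
  then show ?thesis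
    using openin_r_coset[OF V] S by (auto simp: subset_iff intro!: openin_Union)
qed

text \<open>\<open>H = H <#> W\<close> is a union of open translates of \<open>W\<close>.\<close>

lemma openin_subgroup_of_nhd:
  assumes H: "subgroup H G" and W: "openin T W" "\<one> \<in> W" "W \<subseteq> H"
  shows "openin T H"
proof -
  have "H <#> W = H"
  proof
    show "H <#> W \<subseteq> H"
      using W(3) subgroup.m_closed[OF H] by (auto simp: set_mult_def)
    show "H \<subseteq> H <#> W"
      using W(2) subgroup.mem_carrier[OF H] by (force simp: set_mult_def)
  qed
  then show ?thesis
    using openin_set_mult_right[OF W(1)] subgroup.subset[OF H] by metis
qed

text \<open>The complement is stable under right multiplication by \<open>H\<close>, so it is a
  union of open cosets.\<close>

lemma closedin_open_subgroup:
  assumes H: "subgroup H G" and O: "openin T H"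
  shows "closedin T H"
proof -
  have "carrier G - H = (carrier G - H) <#> H"
  proof
    show "carrier G - H \<subseteq> (carrier G - H) <#> H"
      using subgroup.one_closed[OF H] by (force simp: set_mult_def)
    have "x \<in> H" if "x \<in> carrier G" "h \<in> H" "x \<otimes> h \<in> H" for x h
      using that subgroup.m_closed[OF H that(3) subgroup.m_inv_closed[OF H that(2)]]
        subgroup.mem_carrier[OF H] by (simp add: m_assoc)
    then show "(carrier G - H) <#> H \<subseteq> carrier G - H"
      using subgroup.mem_carrier[OF H] by (auto simp: set_mult_def)
  qed
  then have "openin T (carrier G - H)"
    using openin_set_mult_right[OF O, of "carrier G - H"] by auto
  then show ?thesis
    using subgroup.subset[OF H] by (simp add: closedin_def topspace_eq_carrier)
qed

text \<open>The right stabilizer of \<open>K\<close> is a subgroup inside \<open>K\<close> because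
  \<open>\<one> \<in> K\<close>. The tube lemma makes it open, hence closed, and a closed subset of
  \<open>K\<close> is compact.\<close>

lemma compact_open_subgroup_in_clopen:
  assumes K: "compactin T K" "openin T K" and one: "\<one> \<in> K"
  shows "\<exists>V. compact_open_subgroup G T V \<and> V \<subseteq> K"
proof -
  have KG: "K \<subseteq> carrier G"
    using openin_subset[OF K(2)] topspace_eq_carrier by simp
  \<comment> \<open>Requiring the condition for \<open>x\<close> and for \<open>inv x\<close> makes
    the set closed under inversion.\<close>
  define V where "V = {x \<in> carrier G. \<forall>k\<in>K. k \<otimes> x \<in> K \<and> k \<otimes> inv x \<in> K}"
  have V: "subgroup V G"
  proof
    show "x \<otimes> y \<in> V" if "x \<in> V" "y \<in> V" for x y
      using that KG by (auto simp: V_def inv_mult_group m_assoc[symmetric] subset_iff)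
    show "\<one> \<in> V" "V \<subseteq> carrier G" "\<And>x. x \<in> V \<Longrightarrow> inv x \<in> V"
      using KG by (auto simp: V_def)
  qed
  have VK: "V \<subseteq> K"
    using one by (force simp: V_def)
  define m where "m = (\<lambda>(x, y). x \<otimes> y)"
  define W where "W = {p \<in> topspace (prod_topology T T). m p \<in> K}"
  have "openin (prod_topology T T) W"
    unfolding W_def m_def using continuous_mult K(2) by (rule openin_continuous_map_preimage)
  moreover have "K \<times> {\<one>} \<subseteq> W"
    using KG by (auto simp: W_def m_def topspace_eq_carrier)
  \<comment> \<open>Compactness of \<open>K\<close> gives one neighbourhood \<open>B\<close> of the
    identity with \<open>k \<otimes> x \<in> K\<close> for all \<open>k \<in> K\<close> and
    \<open>x \<in> B\<close>; \<open>B'\<close> below makes it symmetric.\<close>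
  ultimately obtain A B where AB: "openin T A" "openin T B" "K \<subseteq> A" "\<one> \<in> B" "A \<times> B \<subseteq> W"
    using tube_lemma_left[of T T W K \<one>] K(1) topspace_eq_carrier by auto
  define B' where "B' = B \<inter> {x \<in> topspace T. inv x \<in> B}"
  have "openin T B'"
    unfolding B'_def using AB(2) continuous_inv by (intro openin_Int openin_continuous_map_preimage)
  moreover have "\<one> \<in> B'"
    using AB(4) by (simp add: B'_def topspace_eq_carrier)
  moreover have "B' \<subseteq> V"
    using AB(3,5) by (fastforce simp: B'_def V_def W_def m_def topspace_eq_carrier)
  ultimately have "openin T V"
    using openin_subgroup_of_nhd[OF V] by blast
  then show ?thesis
    using V VK K(1) closedin_open_subgroup[OF V]
    by (auto simp: compact_open_subgroup_def intro: closed_compactin)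
qed

text \<open>
  The metric is the left invariant ultrametric for which the cosets of the subgroups \<open>W n\<close> are
  the balls of radius \<open>1 / Suc n\<close>.
\<close>

lemma metrizable_of_subgroup_base:
  assumes sub: "\<And>n. subgroup (W n) G" and op: "\<And>n. openin T (W n)" and dec: "decseq W"
    and base: "\<And>U. openin T U \<Longrightarrow> \<one> \<in> U \<Longrightarrow> \<exists>n. W n \<subseteq> U"
  shows "metrizable_space T"
proof -
  \<comment> \<open>For \<open>x = y\<close> no \<open>n\<close> satisfies the \<open>LEAST\<close>
    condition, hence the separate value 0. Off the carrier 0 keeps \<open>d\<close> nonnegative and
    symmetric everywhere, as \<open>Metric_space\<close> demands.\<close>
  define d where "d x y = (if x \<notin> carrier G \<or> y \<notin> carrier G \<or> x = y then 0
    else inverse (real (Suc (LEAST n. inv x \<otimes> y \<notin> W n))))" for x y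
  have WG: "W n \<subseteq> carrier G" for n
    using subgroup.subset[OF sub] .
  have one: "\<one> \<in> W n" for n
    using subgroup.one_closed[OF sub] .
  \<comment> \<open>Points are closed, so some \<open>W n\<close> avoids \<open>g\<close>; this
    makes the \<open>LEAST\<close> in \<open>d\<close> meaningful for distinct points.\<close>
  have sep: "\<exists>n. g \<notin> W n" if "g \<in> carrier G" "g \<noteq> \<one>" for g
  proof -
    have "openin T (topspace T - {g})"
      using Hausdorff that(1) closedin_Hausdorff_singleton[of T g] topspace_eq_carrier by blast
    then show ?thesis
      using base[of "topspace T - {g}"] that by (auto simp: topspace_eq_carrier)
  qed
  have d_less: "d x y < inverse (real (Suc n)) \<longleftrightarrow> inv x \<otimes> y \<in> W n"
    if xy: "x \<in> carrier G" "y \<in> carrier G" for x y n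
  proof (cases "x = y")
    case True
    then show ?thesis using one xy by (simp add: d_def)
  next
    case False
    define L where "L = (LEAST n. inv x \<otimes> y \<notin> W n)"
    obtain m where "inv x \<otimes> y \<notin> W m"
      using sep[of "inv x \<otimes> y"] False xy inv_equality[of "inv x" y] by (metis inv_closed inv_inv m_closed)
    then have "inv x \<otimes> y \<notin> W L"
      unfolding L_def by (rule LeastI)
    then have "n < L" if "inv x \<otimes> y \<in> W n"
      using that decseqD[OF dec, of L n] by (meson not_le_imp_less subsetD)
    moreover have "inv x \<otimes> y \<in> W n" if "n < L"
      using not_less_Least that unfolding L_def by blast
    ultimately have "inv x \<otimes> y \<in> W n \<longleftrightarrow> n < L"
      by blast
    then show ?thesis
      using False xy by (simp add: d_def L_def[symmetric])
  qed
  have d_nonneg: "0 \<le> d x y" for x y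
    by (simp add: d_def)
  have d_zero: "d x y = 0 \<longleftrightarrow> x = y" if "x \<in> carrier G" "y \<in> carrier G" for x y
    using that by (auto simp: d_def)
  \<comment> \<open>It suffices to test thresholds \<open>inverse (Suc n)\<close>, since these are
    the only nonzero values of \<open>d\<close>: if \<open>d x y > e\<close> were such a value,
    membership in \<open>W n\<close> would push \<open>d x y\<close> strictly below itself.\<close>
  have d_le: "d x y \<le> e" if "x \<in> carrier G" "y \<in> carrier G"
    "e \<ge> 0" "\<And>n. inverse (real (Suc n)) > e \<Longrightarrow> inv x \<otimes> y \<in> W n" for x y e
  proof (rule ccontr)
    assume "\<not> d x y \<le> e"
    then have "d x y > e" by simp
    moreover from this obtain n where "d x y = inverse (real (Suc n))"
      using \<open>e \<ge> 0\<close> by (auto simp: d_def split: if_splits)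
    ultimately show False
      using that(4)[of n] d_less[OF that(1,2), of n] by simp
  qed
  interpret M: Metric_space "carrier G" d
  proof
    fix x y z
    show "0 \<le> d x y" by (rule d_nonneg)
    have le: "d x y \<le> d y x" if "x \<in> carrier G" "y \<in> carrier G" for x y
    proof (rule d_le)
      fix n assume "d y x < inverse (real (Suc n))"
      then have "inv (inv y \<otimes> x) \<in> W n"
        using d_less that subgroup.m_inv_closed[OF sub] by blast
      then show "inv x \<otimes> y \<in> W n"
        using that by (simp add: inv_mult_group)
    qed (use that d_nonneg in auto)
    show "d x y = d y x"
    proof (cases "x \<in> carrier G \<and> y \<in> carrier G")
      case True
      then show ?thesis using le[of x y] le[of y x] by simp
    qed (auto simp: d_def)
    show "d x y = 0 \<longleftrightarrow> x = y" if "x \<in> carrier G" "y \<in> carrier G"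
      using d_zero that .
    \<comment> \<open>If the sum is below a threshold, so are both terms, and closure of
      \<open>W n\<close> under products handles \<open>x\<close> and \<open>z\<close>.\<close>
    show "d x z \<le> d x y + d y z" if xyz: "x \<in> carrier G" "y \<in> carrier G" "z \<in> carrier G"
    proof (rule d_le)
      fix n assume "d x y + d y z < inverse (real (Suc n))"
      then have "d x y < inverse (real (Suc n))" "d y z < inverse (real (Suc n))"
        using d_nonneg[of x y] d_nonneg[of y z] by linarith+
      then have "(inv x \<otimes> y) \<otimes> (inv y \<otimes> z) \<in> W n"
        using d_less xyz by (simp add: subgroup.m_closed[OF sub])
      moreover have "(inv x \<otimes> y) \<otimes> (inv y \<otimes> z) = inv x \<otimes> z"
        using xyz m_assoc[of y "inv y" z, symmetric] by (simp add: m_assoc)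
      ultimately show "inv x \<otimes> z \<in> W n" by simp
    qed (use xyz d_nonneg in auto)
  qed
  \<comment> \<open>Left translation reduces the comparison at \<open>x\<close> to the identity,
    where the \<open>W n\<close> form a base.\<close>
  have "openin T U \<longleftrightarrow> openin M.mtopology U" for U
  proof
    assume U: "openin T U"
    then have UG: "U \<subseteq> carrier G"
      using openin_subset topspace_eq_carrier by metis
    have "\<exists>r>0. M.mball x r \<subseteq> U" if x: "x \<in> U" for x
    proof -
      have xG: "x \<in> carrier G" using x UG by blast
      have "\<one> \<in> inv x <# U"
        using x xG by (force simp: l_coset_def)
      then obtain n where n: "W n \<subseteq> inv x <# U"
        using base[of "inv x <# U"] openin_l_coset[OF U] xG by auto
      have "y \<in> U" if y: "y \<in> carrier G" "inv x \<otimes> y \<in> W n" for y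
      proof -
        obtain u where "u \<in> U" "inv x \<otimes> y = inv x \<otimes> u"
          using n y(2) by (auto simp: l_coset_def)
        then show ?thesis using y(1) xG UG by (auto simp: subset_iff)
      qed
      then have "M.mball x (inverse (real (Suc n))) \<subseteq> U"
        using d_less xG by (auto simp: M.mball_def)
      then show ?thesis
        by (intro exI[of _ "inverse (real (Suc n))"]) auto
    qed
    with UG show "openin M.mtopology U"
      by (simp add: M.openin_mtopology)
  next
    assume U: "openin M.mtopology U"
    then have UG: "U \<subseteq> carrier G"
      by (simp add: M.openin_mtopology)
    have "\<exists>S. openin T S \<and> x \<in> S \<and> S \<subseteq> U" if x: "x \<in> U" for x
    proof -
      have xG: "x \<in> carrier G" using x UG by blast
      obtain r where r: "r > 0" "M.mball x r \<subseteq> U"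
        using U x by (auto simp: M.openin_mtopology)
      obtain n where n: "inverse (real (Suc n)) < r"
        using reals_Archimedean r(1) by blast
      have "x \<otimes> w \<in> U" if w: "w \<in> W n" for w
      proof -
        have wG: "w \<in> carrier G" using w WG by blast
        then have "d x (x \<otimes> w) < inverse (real (Suc n))"
          using d_less[of x "x \<otimes> w" n] xG w by (simp add: m_assoc[symmetric])
        then have "x \<otimes> w \<in> M.mball x r"
          using n xG wG by simp
        then show ?thesis using r(2) by blast
      qed
      then have "x <# W n \<subseteq> U"
        by (auto simp: l_coset_def)
      moreover have "x \<in> x <# W n"
        using one xG by (force simp: l_coset_def)
      ultimately show ?thesis
        using openin_l_coset[OF op xG] by blast
    qed
    then show "openin T U"
      using openin_subopen by blast
  qed
  then have "T = M.mtopology"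
    by (simp add: topology_eq)
  then show ?thesis
    using M.metrizable_space_mtopology by simp
qed

end

section \<open>Van Dantzig's theorem\<close>

lemma (in tdlc_group) van_Dantzig:
  assumes W: "openin T W" "\<one> \<in> W"
  shows "\<exists>V. compact_open_subgroup G T V \<and> V \<subseteq> W"
proof -
  obtain A K where AK: "openin T A" "compactin T K" "\<one> \<in> A" "A \<subseteq> K"
    using locally_compact one_closed unfolding locally_compact_space_def topspace_eq_carrier by metis
  have "{\<one>} \<in> connected_components_of T"
    using totally_disconnected
    by (force simp: connected_components_of_def totally_disconnected_space_def topspace_eq_carrier)
  moreover have "compactin T {\<one>}"
    by (simp add: topspace_eq_carrier)
  \<comment> \<open>The component \<open>{\<one>}\<close> is compact, so in a locally compact
    Hausdorff space it has clopen neighbourhoods inside any given open one. Intersecting with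
    \<open>A\<close> makes \<open>U\<close> compact as well.\<close>
  ultimately obtain U U' where U: "openin T U" "openin T U'" "disjnt U U'" "U \<union> U' = topspace T"
      "{\<one>} \<subseteq> U" "U \<subseteq> A \<inter> W"
    using wilder_locally_compact_component_thm[OF locally_compact Hausdorff, of "{\<one>}" "A \<inter> W"]
      AK W by blast
  have "U = topspace T - U'"
    using U(3,4) by (auto simp: disjnt_iff)
  then have "closedin T U"
    using U(2) by auto
  then have "compactin T U"
    using closed_compactin[OF AK(2)] AK(4) U(6) by blast
  then show ?thesis
    using compact_open_subgroup_in_clopen[of U] U by blast
qed


section \<open>Powers of the automorphism and orbit windows\<close>

text \<open>Common form of all the sets built from \<open>V\<close>: the windows
  \<open>{..0}\<close>, \<open>{0..}\<close> and \<open>UNIV\<close> give \<open>V_plus\<close>,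
  \<open>V_minus\<close> and \<open>V_zero\<close>. Applying a power of \<open>\<alpha>\<close>
  becomes a translation of \<open>N\<close>, and intersecting sets becomes a union of
  windows.\<close>

definition orbit_window ::
  "('a, 'b) monoid_scheme \<Rightarrow> ('a \<Rightarrow> 'a) \<Rightarrow> 'a set \<Rightarrow> int set \<Rightarrow> 'a set" where
  "orbit_window G \<alpha> V N = {x \<in> carrier G. \<forall>n\<in>N. aut_pow G \<alpha> n x \<in> V}"

context topological_automorphism
begin

lemma bij_betw_aut: "bij_betw \<alpha> (carrier G) (carrier G)"
  using automorphism by (simp add: iso_def)

lemma aut_closed [simp]: "x \<in> carrier G \<Longrightarrow> \<alpha> x \<in> carrier G"
  using bij_betw_aut by (auto simp: bij_betw_def)

lemma aut_inv_closed [simp]: "x \<in> carrier G \<Longrightarrow> aut_inv G \<alpha> x \<in> carrier G"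
  using bij_betw_aut unfolding aut_inv_def by (metis bij_betw_def inv_into_into)

lemma aut_aut_inv [simp]: "x \<in> carrier G \<Longrightarrow> \<alpha> (aut_inv G \<alpha> x) = x"
  using bij_betw_aut unfolding aut_inv_def by (metis bij_betw_def f_inv_into_f)

lemma aut_inv_aut [simp]: "x \<in> carrier G \<Longrightarrow> aut_inv G \<alpha> (\<alpha> x) = x"
  using bij_betw_aut unfolding aut_inv_def by (metis bij_betw_def inv_into_f_f)

lemma aut_pow_0 [simp]: "aut_pow G \<alpha> 0 = (\<lambda>x. x)"
  by (auto simp: aut_pow_def)

lemma aut_pow_1 [simp]: "aut_pow G \<alpha> 1 = \<alpha>"
  by (simp add: aut_pow_def)

lemma aut_pow_of_nat: "aut_pow G \<alpha> (int n) = \<alpha> ^^ n"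
  by (simp add: aut_pow_def)

lemma continuous_aut_pow: "continuous_map T T (aut_pow G \<alpha> n)"
proof -
  have "continuous_map T T (f ^^ k)" if "continuous_map T T f" for f k
    using that by (induction k) (auto intro: continuous_map_compose simp: id_def)
  then show ?thesis
    using continuous_aut continuous_aut_inv by (simp add: aut_pow_def)
qed

lemma aut_pow_hom: "aut_pow G \<alpha> n \<in> hom G G"
proof -
  have "f ^^ k \<in> hom G G" if "f \<in> hom G G" for f k
    using that by (induction k) (auto simp: hom_def Pi_iff)
  moreover have "\<alpha> \<in> hom G G" "aut_inv G \<alpha> \<in> hom G G"
    using automorphism iso_set_sym[OF automorphism] by (auto simp: iso_def aut_inv_def)
  ultimately show ?thesis
    by (simp add: aut_pow_def)
qed

lemma aut_pow_closed [simp]: "x \<in> carrier G \<Longrightarrow> aut_pow G \<alpha> n x \<in> carrier G"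
  using aut_pow_hom by (rule hom_in_carrier)

lemma aut_pow_mult:
  "x \<in> carrier G \<Longrightarrow> y \<in> carrier G \<Longrightarrow>
    aut_pow G \<alpha> n (x \<otimes> y) = aut_pow G \<alpha> n x \<otimes> aut_pow G \<alpha> n y"
  using aut_pow_hom by (rule hom_mult)

lemma aut_pow_one [simp]: "aut_pow G \<alpha> n \<one> = \<one>"
  using hom_one[OF aut_pow_hom] by simp

lemma aut_pow_inv: "x \<in> carrier G \<Longrightarrow> aut_pow G \<alpha> n (inv x) = inv (aut_pow G \<alpha> n x)"
  using group_hom.hom_inv[of G G "aut_pow G \<alpha> n"] aut_pow_hom
  by (simp add: group_hom_def group_hom_axioms_def)

lemma aut_pow_Suc:
  assumes "x \<in> carrier G"
  shows "aut_pow G \<alpha> (n + 1) x = \<alpha> (aut_pow G \<alpha> n x)"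
proof (cases "0 \<le> n")
  case True
  then show ?thesis by (simp add: aut_pow_def nat_add_distrib)
next
  case False
  \<comment> \<open>With \<open>n = -(k + 1)\<close>, the outermost inverse in
    \<open>aut_pow G \<alpha> n\<close> cancels against \<open>\<alpha>\<close>.\<close>
  then obtain k where n: "n = - int (Suc k)"
    by (metis negD not_le)
  have "(aut_inv G \<alpha> ^^ k) x \<in> carrier G"
    using assms by (induction k) auto
  moreover have "aut_pow G \<alpha> n = aut_inv G \<alpha> ^^ Suc k"
    using n by (simp add: aut_pow_def nat_add_distrib)
  moreover have "n + 1 = - int k"
    using n by simp
  ultimately show ?thesis
    by (simp add: aut_pow_def)
qed

lemma aut_pow_add:
  assumes "x \<in> carrier G"
  shows "aut_pow G \<alpha> (m + n) x = aut_pow G \<alpha> m (aut_pow G \<alpha> n x)"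
proof (induction m rule: int_induct[where k = 0])
  case (step1 i)
  then show ?case
    using assms aut_pow_Suc[of x "i + n"] aut_pow_Suc[of "aut_pow G \<alpha> n x" i]
    by (simp add: algebra_simps)
next
  case (step2 i)
  \<comment> \<open>For the downward step both sides are compared after applying
    \<open>\<alpha>\<close>, which is injective on the carrier.\<close>
  then have "\<alpha> (aut_pow G \<alpha> (i - 1 + n) x) = \<alpha> (aut_pow G \<alpha> (i - 1) (aut_pow G \<alpha> n x))"
    using assms aut_pow_Suc[of x "i - 1 + n"] aut_pow_Suc[of "aut_pow G \<alpha> n x" "i - 1"]
    by simp
  then show ?case
    using assms by (metis aut_inv_aut aut_pow_closed)
qed simp

lemma aut_pow_minus [simp]:
  assumes "x \<in> carrier G"
  shows "aut_pow G \<alpha> (- n) (aut_pow G \<alpha> n x) = x" "aut_pow G \<alpha> n (aut_pow G \<alpha> (- n) x) = x"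
  using aut_pow_add[OF assms, of "- n" n] aut_pow_add[OF assms, of n "- n"] by simp_all

lemma aut_pow_image:
  assumes "V \<subseteq> carrier G"
  shows "aut_pow G \<alpha> n ` V = {x \<in> carrier G. aut_pow G \<alpha> (- n) x \<in> V}"
  using assms by (auto simp: subset_iff intro!: rev_image_eqI[of "aut_pow G \<alpha> (- n) _"])

lemma orbit_window_subset_carrier: "orbit_window G \<alpha> V N \<subseteq> carrier G"
  by (auto simp: orbit_window_def)

lemma orbit_window_subset: "0 \<in> N \<Longrightarrow> orbit_window G \<alpha> V N \<subseteq> V"
  by (auto simp: orbit_window_def)

lemma orbit_window_antimono: "M \<subseteq> N \<Longrightarrow> orbit_window G \<alpha> V N \<subseteq> orbit_window G \<alpha> V M"
  by (auto simp: orbit_window_def)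

lemma Inter_orbit_window: "(\<Inter>n. orbit_window G \<alpha> V (N n)) = orbit_window G \<alpha> V (\<Union>n. N n)"
  by (auto simp: orbit_window_def)

lemma aut_pow_in_orbit_window:
  assumes "x \<in> carrier G"
  shows "aut_pow G \<alpha> k x \<in> orbit_window G \<alpha> V N \<longleftrightarrow> x \<in> orbit_window G \<alpha> V ((\<lambda>n. n + k) ` N)"
  using assms by (simp add: orbit_window_def aut_pow_add)

lemma aut_pow_image_orbit_window:
  "aut_pow G \<alpha> k ` orbit_window G \<alpha> V N = orbit_window G \<alpha> V ((\<lambda>n. n - k) ` N)"
  using aut_pow_in_orbit_window[of _ "- k" V N] orbit_window_subset_carrier
  by (auto simp: aut_pow_image)

lemma subgroup_orbit_window:
  assumes V: "subgroup V G"
  shows "subgroup (orbit_window G \<alpha> V N) G"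
  by unfold_locales
    (auto simp: orbit_window_def aut_pow_mult aut_pow_inv subgroup.m_closed[OF V]
      subgroup.m_inv_closed[OF V] subgroup.one_closed[OF V])

lemma closedin_orbit_window:
  assumes "closedin T V"
  shows "closedin T (orbit_window G \<alpha> V N)"
\<comment> \<open>An empty window is treated apart: the intersection over the empty family would be
  \<open>UNIV\<close> instead of the carrier.\<close>
proof (cases "N = {}")
  case True
  then show ?thesis
    using closedin_topspace[of T] by (simp add: orbit_window_def topspace_eq_carrier)
next
  case False
  then have "orbit_window G \<alpha> V N = (\<Inter>n\<in>N. {x \<in> topspace T. aut_pow G \<alpha> n x \<in> V})"
    by (auto simp: orbit_window_def topspace_eq_carrier)
  moreover have "closedin T {x \<in> topspace T. aut_pow G \<alpha> n x \<in> V}" for n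
    using continuous_aut_pow assms by (rule closedin_continuous_map_preimage)
  ultimately show ?thesis
    using False by auto
qed

lemma openin_orbit_window:
  assumes "openin T V" "finite N"
  shows "openin T (orbit_window G \<alpha> V N)"
proof (cases "N = {}")
  case True
  then show ?thesis
    using openin_topspace[of T] by (simp add: orbit_window_def topspace_eq_carrier)
next
  case False
  then have "orbit_window G \<alpha> V N = (\<Inter>n\<in>N. {x \<in> topspace T. aut_pow G \<alpha> n x \<in> V})"
    by (auto simp: orbit_window_def topspace_eq_carrier)
  moreover have "openin T {x \<in> topspace T. aut_pow G \<alpha> n x \<in> V}" for n
    using continuous_aut_pow assms(1) by (rule openin_continuous_map_preimage)
  ultimately show ?thesis
    using False assms(2) by auto
qed

lemma compact_open_subgroupD:
  assumes "compact_open_subgroup G T V"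
  shows "subgroup V G" "compactin T V" "openin T V" "closedin T V" "V \<subseteq> carrier G"
  using assms closedin_open_subgroup subgroup.subset by (auto simp: compact_open_subgroup_def)

text \<open>The condition \<open>0 \<in> N n\<close> keeps the windows inside the compact set
  \<open>V\<close>, where they are closed and decrease to the window of the union. This is the
  compactness argument behind all later parts.\<close>

lemma orbit_window_subset_open:
  assumes V: "compact_open_subgroup G T V" and N: "\<And>n. 0 \<in> N n" "incseq N"
    and W: "openin T W" "orbit_window G \<alpha> V (\<Union>n::nat. N n) \<subseteq> W"
  shows "\<exists>n. orbit_window G \<alpha> V (N n) \<subseteq> W"
proof (rule compactin_nest_subset_open)
  show "compactin T V" "openin T W"
    using compact_open_subgroupD[OF V] W by auto
  show "closedin T (orbit_window G \<alpha> V (N n))" "orbit_window G \<alpha> V (N n) \<subseteq> V" for n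
    using closedin_orbit_window compact_open_subgroupD[OF V] orbit_window_subset N(1) by auto
  show "decseq (\<lambda>n. orbit_window G \<alpha> V (N n))"
    using N(2) orbit_window_antimono by (simp add: decseq_def incseq_def)
  show "(\<Inter>n. orbit_window G \<alpha> V (N n)) \<subseteq> W"
    using W(2) by (simp add: Inter_orbit_window)
qed

section \<open>The sets \<open>V_plus\<close>, \<open>V_minus\<close> and their unions as
  contraction groups\<close>

text \<open>The sign flips: \<open>x\<close> lies in the image of \<open>V\<close> under the power
  \<open>n\<close> exactly when the power \<open>- n\<close> sends \<open>x\<close> into
  \<open>V\<close>.\<close>

lemma V_plus_eq: "V \<subseteq> carrier G \<Longrightarrow> V_plus G \<alpha> V = orbit_window G \<alpha> V {..0}"
  unfolding V_plus_def orbit_window_def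
  by (auto simp: aut_pow_image) (metis minus_minus neg_0_le_iff_le nonneg_int_cases)

lemma V_minus_eq: "V \<subseteq> carrier G \<Longrightarrow> V_minus G \<alpha> V = orbit_window G \<alpha> V {0..}"
  unfolding V_minus_def orbit_window_def
  by (auto simp: aut_pow_image) (metis nonneg_int_cases)

lemma V_zero_eq_orbit_window: "V \<subseteq> carrier G \<Longrightarrow> V_zero G \<alpha> V = orbit_window G \<alpha> V UNIV"
  by (auto simp: V_zero_def V_plus_eq V_minus_eq orbit_window_def) (metis atLeast_iff atMost_iff linear)

text \<open>Thus membership in \<open>V_minusminus\<close> says that the forward orbit eventually
  stays in \<open>V\<close>.\<close>

lemma V_minusminus_eq_UN:
  "V \<subseteq> carrier G \<Longrightarrow> V_minusminus G \<alpha> V = (\<Union>n::nat. orbit_window G \<alpha> V {int n..})"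
  unfolding V_minusminus_def
  using image_add_atLeast[of "int _" 0] by (simp add: V_minus_eq aut_pow_image_orbit_window add.commute)

text \<open>An orbit tending to the identity eventually stays in the open set \<open>V\<close>.
  Conversely, staying in \<open>V\<close> from time \<open>m\<close> on forces convergence, because
  the windows \<open>{- int k..}\<close> shrink to \<open>V_zero\<close>, which is trivial.\<close>

lemma V_minusminus_eq_contraction_group:
  assumes V: "compact_open_subgroup G T V" and V0: "V_zero G \<alpha> V = {\<one>}"
  shows "V_minusminus G \<alpha> V = contraction_group G T \<alpha>"
proof -
  note VD = compact_open_subgroupD[OF V]
  have "x \<in> contraction_group G T \<alpha>" if x: "x \<in> orbit_window G \<alpha> V {int m..}" for x m
  proof -
    have xG: "x \<in> carrier G"
      using x orbit_window_subset_carrier by blast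
    have "eventually (\<lambda>n. (\<alpha> ^^ n) x \<in> W) sequentially" if W: "openin T W" "\<one> \<in> W" for W
    proof -
      have "i \<in> {- int (nat (- i))..}" for i
        by simp
      then have "(\<Union>n. {- int n..}) = UNIV"
        by blast
      then obtain k where k: "orbit_window G \<alpha> V {- int k..} \<subseteq> W"
        using orbit_window_subset_open[OF V, of "\<lambda>n. {- int n..}" W] W V0 VD(5)
        by (auto simp: V_zero_eq_orbit_window incseq_def)
      \<comment> \<open>After \<open>m + k\<close> steps the orbit also has its last
        \<open>k\<close> positions in \<open>V\<close>, so it lies in the window found
        above.\<close>
      have "(\<alpha> ^^ n) x \<in> W" if "n \<ge> m + k" for n
      proof -
        have "(\<lambda>i. i + int n) ` {- int k..} \<subseteq> {int m..}"
          using that by auto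
        then have "aut_pow G \<alpha> (int n) x \<in> orbit_window G \<alpha> V {- int k..}"
          using x xG orbit_window_antimono by (subst aut_pow_in_orbit_window) blast+
        then show ?thesis
          using k by (auto simp: aut_pow_of_nat)
      qed
      then show ?thesis
        by (auto simp: eventually_sequentially)
    qed
    then show ?thesis
      using xG by (auto simp: contraction_group_def limitin_def topspace_eq_carrier)
  qed
  moreover have "\<exists>m. x \<in> orbit_window G \<alpha> V {int m..}" if x: "x \<in> contraction_group G T \<alpha>" for x
  proof -
    have "eventually (\<lambda>n. (\<alpha> ^^ n) x \<in> V) sequentially"
      using x VD subgroup.one_closed[OF VD(1)] by (auto simp: contraction_group_def limitin_def)
    then obtain m where m: "\<And>n. n \<ge> m \<Longrightarrow> (\<alpha> ^^ n) x \<in> V"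
      by (auto simp: eventually_sequentially)
    have "aut_pow G \<alpha> i x \<in> V" if "i \<ge> int m" for i
      using m[of "nat i"] that by (simp add: aut_pow_def le_nat_iff)
    then show ?thesis
      using x by (auto simp: orbit_window_def contraction_group_def)
  qed
  ultimately show ?thesis
    using VD(5) by (auto simp: V_minusminus_eq_UN)
qed

lemma aut_inv_aut_inv:
  assumes "x \<in> carrier G"
  shows "aut_inv G (aut_inv G \<alpha>) x = \<alpha> x"
proof -
  have "inj_on (aut_inv G \<alpha>) (carrier G)"
    using bij_betw_inv_into[OF bij_betw_aut] unfolding aut_inv_def bij_betw_def by simp
  then have "inv_into (carrier G) (aut_inv G \<alpha>) (aut_inv G \<alpha> (\<alpha> x)) = \<alpha> x"
    using assms by (intro inv_into_f_f) auto
  then show ?thesis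
    using assms unfolding aut_inv_def[of G "aut_inv G \<alpha>"] by simp
qed

lemma aut_pow_aut_inv:
  assumes "x \<in> carrier G"
  shows "aut_pow G (aut_inv G \<alpha>) n x = aut_pow G \<alpha> (- n) x"
proof (cases "0 \<le> n")
  case True
  then show ?thesis by (simp add: aut_pow_def)
next
  case False
  have "(aut_inv G (aut_inv G \<alpha>) ^^ k) x = (\<alpha> ^^ k) x \<and> (\<alpha> ^^ k) x \<in> carrier G" for k
    using assms by (induction k) (auto simp: aut_inv_aut_inv)
  with False show ?thesis by (simp add: aut_pow_def)
qed

text \<open>Makes every result available for the inverse. The double inverse is identified with
  \<open>\<alpha>\<close> on the carrier, which suffices for continuity.\<close>

lemma topological_automorphism_aut_inv: "topological_automorphism G T (aut_inv G \<alpha>)"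
proof unfold_locales
  show "aut_inv G \<alpha> \<in> iso G G"
    using iso_set_sym[OF automorphism] by (simp add: aut_inv_def)
  show "continuous_map T T (aut_inv G \<alpha>)"
    by (rule continuous_aut_inv)
  show "continuous_map T T (aut_inv G (aut_inv G \<alpha>))"
    using continuous_aut by (rule continuous_map_eq) (simp add: aut_inv_aut_inv topspace_eq_carrier)
qed

lemma aut_pow_aut_inv_image:
  "V \<subseteq> carrier G \<Longrightarrow> aut_pow G (aut_inv G \<alpha>) n ` V = aut_pow G \<alpha> (- n) ` V"
  by (intro image_cong) (auto simp: aut_pow_aut_inv)

lemma V_plus_subset: "V_plus G \<alpha> V \<subseteq> V" and V_minus_subset: "V_minus G \<alpha> V \<subseteq> V"
  by (auto simp: V_plus_def V_minus_def dest!: INT_D[where a = 0])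

lemma V_plus_aut_inv: "V \<subseteq> carrier G \<Longrightarrow> V_plus G (aut_inv G \<alpha>) V = V_minus G \<alpha> V"
  and V_minus_aut_inv: "V \<subseteq> carrier G \<Longrightarrow> V_minus G (aut_inv G \<alpha>) V = V_plus G \<alpha> V"
  by (simp_all add: V_plus_def V_minus_def aut_pow_aut_inv_image)

text \<open>Passing to the inverse automorphism exchanges \<open>V_plus\<close> with
  \<open>V_minus\<close> and fixes \<open>V_zero\<close>, so the statement on
  \<open>V_minusminus\<close> applies.\<close>

lemma V_plusplus_eq_contraction_group:
  assumes V: "compact_open_subgroup G T V" and V0: "V_zero G \<alpha> V = {\<one>}"
  shows "V_plusplus G \<alpha> V = contraction_group G T (aut_inv G \<alpha>)"
proof -
  interpret inverse: topological_automorphism G T "aut_inv G \<alpha>"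
    by (rule topological_automorphism_aut_inv)
  have VG: "V \<subseteq> carrier G"
    using compact_open_subgroupD[OF V] by simp
  then have "V_zero G (aut_inv G \<alpha>) V = {\<one>}"
    using V0 by (auto simp: V_zero_def V_plus_aut_inv V_minus_aut_inv)
  moreover have "V_plusplus G \<alpha> V = V_minusminus G (aut_inv G \<alpha>) V"
    using VG V_plus_subset[of V]
    by (auto simp: V_plusplus_def V_minusminus_def V_minus_aut_inv aut_pow_aut_inv_image)
  ultimately show ?thesis
    using inverse.V_minusminus_eq_contraction_group V by simp
qed

section \<open>A compact open subgroup with \<open>U = U\<^sub>+U\<^sub>-\<close>\<close>

text \<open>
  Compactness gives \<open>\<alpha>(U) \<subseteq> \<alpha>(U\<^sub>+)V\<close> for \<open>U = \<Inter>\<^bsub>0\<le>k\<le>n\<^esub> \<alpha>\<^sup>k(V)\<close> and some \<open>n\<close>. This makes it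
  possible to split off from an element of \<open>U\<close> factors in \<open>U\<^sub>+\<close> so that longer and longer pieces
  of the forward orbit of the rest stay in \<open>U\<close>.
\<close>

lemma tidy_subgroup:
  assumes V: "compact_open_subgroup G T V"
  shows "\<exists>U. compact_open_subgroup G T U \<and> U \<subseteq> V \<and> U = V_plus G \<alpha> U <#> V_minus G \<alpha> U"
proof -
  note VD = compact_open_subgroupD[OF V]
  let ?P = "orbit_window G \<alpha> V {..0}"
  have sub: "subgroup (orbit_window G \<alpha> V N) G" for N
    using subgroup_orbit_window VD(1) by blast
  note mem_mono = orbit_window_antimono[THEN subsetD]
  note carrierD = orbit_window_subset_carrier[THEN subsetD]
  \<comment> \<open>Here \<open>orbit_window G \<alpha> V {..- 1}\<close> is
    \<open>\<alpha>(V\<^sub>+)\<close>. The windows \<open>{- int n..0}\<close> decrease to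
    \<open>V\<^sub>+\<close>, which lies in the open set on the right, so one of them does
    too.\<close>
  have "\<exists>n. orbit_window G \<alpha> V {- int n..0} \<subseteq> aut_pow G \<alpha> (- 1) ` (orbit_window G \<alpha> V {..- 1} <#> V)"
  proof (rule orbit_window_subset_open[OF V])
    have "openin T (orbit_window G \<alpha> V {..- 1} <#> V)"
      using openin_set_mult_right VD(3) orbit_window_subset_carrier by blast
    moreover have "orbit_window G \<alpha> V {..- 1} <#> V \<subseteq> carrier G"
      using set_mult_closed orbit_window_subset_carrier VD(5) by blast
    ultimately show "openin T (aut_pow G \<alpha> (- 1) ` (orbit_window G \<alpha> V {..- 1} <#> V))"
      using openin_continuous_map_preimage[OF continuous_aut_pow[of 1]]
      by (simp add: aut_pow_image topspace_eq_carrier)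
    have "i \<in> {- int (nat (- i))..0}" if "i \<in> {..0}" for i
      using that by simp
    then have "{..0} \<subseteq> (\<Union>n. {- int n..0})"
      by blast
    then have "(\<Union>n. {- int n..0}) = {..0}"
      by auto
    moreover have "x \<in> aut_pow G \<alpha> (- 1) ` (orbit_window G \<alpha> V {..- 1} <#> V)" if x: "x \<in> ?P" for x
    proof -
      have xG: "x \<in> carrier G"
        using x carrierD by blast
      have "(\<lambda>n. n + 1) ` {..- 1} \<subseteq> {..0 :: int}"
        by auto
      then have "aut_pow G \<alpha> 1 x \<in> orbit_window G \<alpha> V {..- 1}"
        using aut_pow_in_orbit_window[OF xG] x mem_mono by blast
      then have "aut_pow G \<alpha> 1 x \<otimes> \<one> \<in> orbit_window G \<alpha> V {..- 1} <#> V"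
        using subgroup.one_closed[OF VD(1)] unfolding set_mult_def by blast
      then have "aut_pow G \<alpha> 1 x \<in> orbit_window G \<alpha> V {..- 1} <#> V"
        using xG by simp
      then show ?thesis
        using xG aut_pow_minus(1)[OF xG, of 1] by (metis imageI)
    qed
    ultimately show "orbit_window G \<alpha> V (\<Union>n. {- int n..0}) \<subseteq>
        aut_pow G \<alpha> (- 1) ` (orbit_window G \<alpha> V {..- 1} <#> V)"
      by auto
  qed (auto simp: incseq_def)
  then obtain n where n: "orbit_window G \<alpha> V {- int n..0} \<subseteq>
      aut_pow G \<alpha> (- 1) ` (orbit_window G \<alpha> V {..- 1} <#> V)"
    by blast
  define U where "U = orbit_window G \<alpha> V {- int n..0}"
  have UV: "U \<subseteq> V"
    unfolding U_def by (rule orbit_window_subset) simp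
  have U: "compact_open_subgroup G T U"
    unfolding compact_open_subgroup_def
    using sub VD UV closed_compactin[OF VD(2) UV] closedin_orbit_window openin_orbit_window
    by (auto simp: U_def)
  then have UG: "U \<subseteq> carrier G"
    using compact_open_subgroupD by blast
  \<comment> \<open>Being in \<open>U\<close> at time \<open>k\<close> means being in
    \<open>V\<close> throughout \<open>{k - int n..k}\<close>. Hence
    \<open>U\<^sub>+ = V\<^sub>+\<close>, while \<open>U\<^sub>-\<close> starts \<open>n\<close>
    steps earlier than \<open>V\<^sub>-\<close>.\<close>
  have window_U: "orbit_window G \<alpha> U N = orbit_window G \<alpha> V (\<Union>k\<in>N. {k - int n..k})" for N
  proof -
    have "aut_pow G \<alpha> k x \<in> U \<longleftrightarrow> (\<forall>i\<in>{k - int n..k}. aut_pow G \<alpha> i x \<in> V)" if "x \<in> carrier G" for k x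
    proof -
      have "(\<lambda>i. i + k) ` {- int n..0} = {k - int n..k}"
        by simp
      then show ?thesis
        using aut_pow_in_orbit_window[OF that, of k V "{- int n..0}"] that
        unfolding U_def by (simp only: orbit_window_def mem_Collect_eq simp_thms)
    qed
    then show ?thesis
      by (auto simp: orbit_window_def)
  qed
  have "(\<Union>k\<in>{..0}. {k - int n..k}) = {..0}"
    by force
  then have U_plus: "V_plus G \<alpha> U = ?P"
    using UG by (simp add: V_plus_eq window_U)
  \<comment> \<open>A time between \<open>- n\<close> and 0 is covered by the interval ending at 0,
    a later time by the interval ending there.\<close>
  have "i \<in> {max 0 i - int n..max 0 i}" if "i \<ge> - int n" for i
    using that by auto
  then have "(\<Union>k\<in>{0..}. {k - int n..k}) = {- int n..}"
    by (fastforce intro: UN_I[of "max 0 _"])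
  then have U_minus: "V_minus G \<alpha> U = orbit_window G \<alpha> V {- int n..}"
    using UG by (simp add: V_minus_eq window_U)
  \<comment> \<open>Induction on the time \<open>k\<close> up to which the remainder stays in
    \<open>V\<close>; for \<open>k = 0\<close> the factor is \<open>\<one>\<close>, since
    \<open>U\<close> is the window \<open>{- int n..0}\<close>.\<close>
  have split: "\<exists>a\<in>?P. inv a \<otimes> x \<in> orbit_window G \<alpha> V {- int n..int k}" if "x \<in> U" for x k
  proof (induction k)
    case 0
    then show ?case
      using that UG by (intro bexI[of _ \<one>]) (auto simp: U_def subgroup.one_closed[OF sub])
  next
    case (Suc k)
    then obtain a where a: "a \<in> ?P" "inv a \<otimes> x \<in> orbit_window G \<alpha> V {- int n..int k}"
      by blast
    have xG: "x \<in> carrier G" and aG: "a \<in> carrier G"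
      using that UG a(1) carrierD by blast+
    define y where "y = inv a \<otimes> x"
    have yG: "y \<in> carrier G"
      using xG aG by (simp add: y_def)
    \<comment> \<open>At time \<open>k\<close> the remainder \<open>y\<close> is still in
      \<open>U\<close>, so the choice of \<open>n\<close> factors its next iterate as
      \<open>b \<otimes> z\<close> with \<open>b\<close> in \<open>\<alpha>(V\<^sub>+)\<close> and
      \<open>z\<close> in \<open>V\<close>.\<close>
    have "(\<lambda>i. i + int k) ` {- int n..0} \<subseteq> {- int n..int k}"
      by auto
    then have "aut_pow G \<alpha> (int k) y \<in> orbit_window G \<alpha> V {- int n..0}"
      using aut_pow_in_orbit_window[OF yG] a(2) mem_mono unfolding y_def by blast
    then obtain w where w: "w \<in> orbit_window G \<alpha> V {..- 1} <#> V"
        "aut_pow G \<alpha> (int k) y = aut_pow G \<alpha> (- 1) w"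
      using n by blast
    obtain b z where bz: "b \<in> orbit_window G \<alpha> V {..- 1}" "z \<in> V" "w = b \<otimes> z"
      using w(1) unfolding set_mult_def by blast
    have bG: "b \<in> carrier G" and zG: "z \<in> carrier G"
      using bz VD(5) carrierD by blast+
    have "aut_pow G \<alpha> (int k + 1) y = b \<otimes> z"
      using w(2) bz(3) aut_pow_add[OF yG, of 1 "int k"] aut_pow_minus(2)[of w 1] bG zG
      by (simp add: add.commute)
    \<comment> \<open>Pulling \<open>b\<close> back by \<open>k + 1\<close> steps gives an element
      in \<open>V\<close> at all times up to \<open>k\<close>. Dividing \<open>y\<close> by
      \<open>c\<close> therefore preserves the times already reached and leaves
      \<open>z \<in> V\<close> at time \<open>k + 1\<close>.\<close>
    define c where "c = aut_pow G \<alpha> (- (int k + 1)) b"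
    have "c \<in> orbit_window G \<alpha> V ((\<lambda>i. i + (int k + 1)) ` {..- 1})"
      using aut_pow_in_orbit_window[OF aut_pow_closed[OF bG], of "int k + 1" "- (int k + 1)" V "{..- 1}"]
        aut_pow_minus(2)[OF bG, of "int k + 1"] bz(1) unfolding c_def by metis
    moreover have "{..int k} \<subseteq> (\<lambda>i. i + (int k + 1)) ` {..- 1}"
      by (auto intro: image_eqI[of _ _ "_ - (int k + 1)"])
    ultimately have c: "c \<in> orbit_window G \<alpha> V {..int k}"
      using mem_mono by blast
    then have "a \<otimes> c \<in> ?P"
      using a(1) subgroup.m_closed[OF sub] mem_mono[of "{..0}" "{..int k}"] by auto
    moreover have "inv (a \<otimes> c) \<otimes> x = inv c \<otimes> y"
      using aG bG xG by (simp add: c_def y_def inv_mult_group m_assoc)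
    moreover have "inv c \<otimes> y \<in> orbit_window G \<alpha> V {- int n..int k}"
      using c a(2) subgroup.m_closed[OF sub] subgroup.m_inv_closed[OF sub]
        mem_mono[of "{- int n..int k}" "{..int k}"] unfolding y_def by auto
    moreover have "aut_pow G \<alpha> (int k + 1) (inv c \<otimes> y) = z"
    proof -
      have "aut_pow G \<alpha> (int k + 1) (inv c \<otimes> y) = inv b \<otimes> (b \<otimes> z)"
        using bG yG \<open>aut_pow G \<alpha> (int k + 1) y = b \<otimes> z\<close>
        by (simp only: aut_pow_mult aut_pow_inv c_def inv_closed aut_pow_closed aut_pow_minus)
      then show ?thesis
        using bG zG by (simp add: m_assoc[symmetric])
    qed
    ultimately have "a \<otimes> c \<in> ?P" and "inv (a \<otimes> c) \<otimes> x \<in> orbit_window G \<alpha> V {- int n..int k}"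
      and "aut_pow G \<alpha> (int k + 1) (inv (a \<otimes> c) \<otimes> x) \<in> V"
      using bz(2) by simp_all
    moreover have "{- int n..int (Suc k)} \<subseteq> insert (int k + 1) {- int n..int k}"
      by auto
    ultimately show ?case
      by (intro bexI[of _ "a \<otimes> c"]) (auto simp: orbit_window_def subset_iff)
  qed
  have "x \<in> ?P <#> orbit_window G \<alpha> V {- int n..}" if x: "x \<in> U" for x
  proof -
    have xG: "x \<in> carrier G"
      using x UG by blast
    \<comment> \<open>The first factors that work up to time \<open>k\<close>. These sets are
      closed, nonempty and decreasing in the compact set \<open>V\<close>, so one factor works for
      all times.\<close>
    define C where "C k = ?P \<inter> {a \<in> topspace T. inv a \<otimes> x \<in> orbit_window G \<alpha> V {- int n..int k}}" for k
    have "continuous_map T T (\<lambda>a. inv a \<otimes> x)"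
      using xG continuous_inv by (intro continuous_map_group_mult) (auto simp: topspace_eq_carrier)
    then have "closedin T (C k)" for k
      unfolding C_def using VD(4)
      by (intro closedin_Int closedin_orbit_window closedin_continuous_map_preimage[where Y = T])
    moreover have "C k \<subseteq> V" for k
      using orbit_window_subset[of "{..0}" V] by (auto simp: C_def)
    moreover have "C k \<noteq> {}" for k
      using split[OF x, of k] carrierD by (auto simp: C_def topspace_eq_carrier)
    moreover have "decseq C"
    proof (rule decseq_SucI)
      show "C (Suc k) \<subseteq> C k" for k
        unfolding C_def using mem_mono[of "{- int n..int k}" "{- int n..int (Suc k)}"] by auto
    qed
    ultimately have "(\<Inter>k. C k) \<noteq> {}"
      using compactin_nest[OF VD(2)] by blast
    then obtain a where a: "\<And>k. a \<in> C k"
      by blast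
    then have aP: "a \<in> ?P" and aG: "a \<in> carrier G"
      using a by (auto simp: C_def topspace_eq_carrier)
    have "inv a \<otimes> x \<in> orbit_window G \<alpha> V {- int n..}"
      unfolding orbit_window_def
    proof (intro CollectI conjI ballI)
      show "inv a \<otimes> x \<in> carrier G"
        using aG xG by simp
      fix i assume "i \<in> {- int n..}"
      then have "i \<in> {- int n..int (nat i)}"
        by simp
      then show "aut_pow G \<alpha> i (inv a \<otimes> x) \<in> V"
        using a[of "nat i"] unfolding C_def orbit_window_def by blast
    qed
    moreover have "a \<otimes> (inv a \<otimes> x) = x"
      using aG xG by (simp add: m_assoc[symmetric])
    ultimately show ?thesis
      using aP unfolding set_mult_def by blast
  qed
  then have "U \<subseteq> V_plus G \<alpha> U <#> V_minus G \<alpha> U"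
    unfolding U_plus U_minus by blast
  moreover have "V_plus G \<alpha> U <#> V_minus G \<alpha> U \<subseteq> U"
    using V_plus_subset[of U] V_minus_subset[of U] subgroup.m_closed[OF compact_open_subgroupD(1)[OF U]]
    by (auto simp: set_mult_def)
  ultimately show ?thesis
    using U UV by blast
qed

section \<open>Openness of the product of the contraction groups\<close>

lemma contraction_group_mult:
  assumes "x \<in> contraction_group G T \<alpha>" "y \<in> contraction_group G T \<alpha>"
  shows "x \<otimes> y \<in> contraction_group G T \<alpha>"
proof -
  have xy: "x \<in> carrier G" "y \<in> carrier G"
    and lim: "limitin T (\<lambda>n. (\<alpha> ^^ n) x) \<one> sequentially" "limitin T (\<lambda>n. (\<alpha> ^^ n) y) \<one> sequentially"
    using assms by (auto simp: contraction_group_def)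
  have "limitin (prod_topology T T) (\<lambda>n. ((\<alpha> ^^ n) x, (\<alpha> ^^ n) y)) (\<one>, \<one>) sequentially"
    using lim by (simp add: limitin_pairwise o_def)
  from continuous_map_limit[OF continuous_mult this]
  have "limitin T (\<lambda>n. (\<alpha> ^^ n) x \<otimes> (\<alpha> ^^ n) y) \<one> sequentially"
    by (simp add: o_def)
  moreover have "(\<alpha> ^^ n) (x \<otimes> y) = (\<alpha> ^^ n) x \<otimes> (\<alpha> ^^ n) y" for n
    using aut_pow_mult[OF xy, of "int n"] by (simp add: aut_pow_of_nat)
  ultimately show ?thesis
    using xy by (simp add: contraction_group_def)
qed

lemma V_minus_subset_contraction_group:
  assumes "compact_open_subgroup G T V" "V_zero G \<alpha> V = {\<one>}"
  shows "V_minus G \<alpha> V \<subseteq> contraction_group G T \<alpha>"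
  unfolding V_minusminus_eq_contraction_group[OF assms, symmetric] V_minusminus_def
  by (rule order_trans[OF _ UN_upper[of 0]]) auto

lemma V_plus_subset_contraction_group:
  assumes "compact_open_subgroup G T V" "V_zero G \<alpha> V = {\<one>}"
  shows "V_plus G \<alpha> V \<subseteq> contraction_group G T (aut_inv G \<alpha>)"
  unfolding V_plusplus_eq_contraction_group[OF assms, symmetric] V_plusplus_def
  by (rule order_trans[OF _ UN_upper[of 0]]) auto

text \<open>Once \<open>V \<subseteq> ?A <#> ?B\<close>, closure of both factors under products lets
  \<open>V\<close> be inserted between them without changing the product, and a product with an open
  factor is open.\<close>

lemma openin_contraction_group_mult:
  assumes V: "compact_open_subgroup G T V" "V = V_plus G \<alpha> V <#> V_minus G \<alpha> V"
    and V0: "V_zero G \<alpha> V = {\<one>}"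
  shows "openin T (contraction_group G T \<alpha> <#> contraction_group G T (aut_inv G \<alpha>))"
    (is "openin T (?A <#> ?B)")
proof -
  interpret inverse: topological_automorphism G T "aut_inv G \<alpha>"
    by (rule topological_automorphism_aut_inv)
  note VD = compact_open_subgroupD[OF V(1)]
  have AG: "?A \<subseteq> carrier G" and BG: "?B \<subseteq> carrier G"
    by (auto simp: contraction_group_def)
  have "x \<in> ?A <#> ?B" if x: "x \<in> V" for x
  proof -
    \<comment> \<open>The factors of \<open>V\<close> come in the wrong order, as
      \<open>V_plus\<close> lies in \<open>?B\<close> and \<open>V_minus\<close> in
      \<open>?A\<close>; inversion reverses them.\<close>
    have "inv x \<in> V_plus G \<alpha> V <#> V_minus G \<alpha> V"
      using V(2) subgroup.m_inv_closed[OF VD(1) x] by blast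
    then obtain a b where ab: "a \<in> V_plus G \<alpha> V" "b \<in> V_minus G \<alpha> V" "inv x = a \<otimes> b"
      unfolding set_mult_def by blast
    have G: "a \<in> carrier G" "b \<in> carrier G" "x \<in> carrier G"
      using ab V_plus_subset[of V] V_minus_subset[of V] VD(5) x by blast+
    have "inv a \<in> V_plus G \<alpha> V" "inv b \<in> V_minus G \<alpha> V"
      using ab VD(5) subgroup.m_inv_closed[OF subgroup_orbit_window[OF VD(1)]]
      by (auto simp: V_plus_eq V_minus_eq)
    then have "inv a \<in> ?B" "inv b \<in> ?A"
      using V_minus_subset_contraction_group V_plus_subset_contraction_group V(1) V0 by blast+
    moreover have "x = inv b \<otimes> inv a"
      using ab(3) G by (metis inv_inv inv_mult_group)
    ultimately show ?thesis
      unfolding set_mult_def by blast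
  qed
  then have VAB: "V \<subseteq> ?A <#> ?B"
    by blast
  have "?A <#> ?B = ?A <#> V <#> ?B"
  proof
    show "?A <#> ?B \<subseteq> ?A <#> V <#> ?B"
      using subgroup.one_closed[OF VD(1)] AG r_one unfolding set_mult_def by (force simp: subset_iff)
    have "?A <#> V <#> ?B \<subseteq> ?A <#> (?A <#> ?B) <#> ?B"
      using VAB by (intro mono_set_mult) auto
    also have "\<dots> = (?A <#> ?A) <#> (?B <#> ?B)"
      using AG BG by (simp add: set_mult_assoc set_mult_closed)
    also have "\<dots> \<subseteq> ?A <#> ?B"
      using contraction_group_mult inverse.contraction_group_mult
      by (intro mono_set_mult) (auto simp: set_mult_def)
    finally show "?A <#> V <#> ?B \<subseteq> ?A <#> ?B" .
  qed
  then show ?thesis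
    using openin_set_mult_left openin_set_mult_right VD(3) AG BG by metis
qed

section \<open>Metrizability and the stable sigma-compact open subgroup\<close>

lemma metrizable_of_trivial_V_zero:
  assumes V: "compact_open_subgroup G T V" and V0: "V_zero G \<alpha> V = {\<one>}"
  shows "metrizable_space T"
proof (rule metrizable_of_subgroup_base)
  note VD = compact_open_subgroupD[OF V]
  let ?W = "\<lambda>n. orbit_window G \<alpha> V {- int n..int n}"
  show "subgroup (?W n) G" "openin T (?W n)" for n
    using subgroup_orbit_window openin_orbit_window VD by auto
  show "decseq ?W"
    by (intro decseq_SucI orbit_window_antimono) auto
  show "\<exists>n. ?W n \<subseteq> U" if "openin T U" "\<one> \<in> U" for U
  proof (rule orbit_window_subset_open[OF V _ _ that(1)])
    have "i \<in> {- int (nat \<bar>i\<bar>)..int (nat \<bar>i\<bar>)}" for i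
      by auto
    then have "(\<Union>n. {- int n..int n}) = UNIV"
      by blast
    then show "orbit_window G \<alpha> V (\<Union>n. {- int n..int n}) \<subseteq> U"
      using that(2) V0 VD(5) by (simp add: V_zero_eq_orbit_window)
  qed (auto simp: incseq_def)
qed

text \<open>Closing \<open>V\<close> under products, inverses, \<open>\<alpha>\<close> and its
  inverse takes countably many stages. Each stage is compact as a finite union of continuous images
  of compact sets, and the result is open because it contains \<open>V\<close>.\<close>

lemma stable_sigma_compact_open_subgroup:
  assumes V: "compact_open_subgroup G T V"
  shows "\<exists>H. subgroup H G \<and> \<alpha> ` H = H \<and> sigma_compactin T H \<and> openin T H"
proof -
  note VD = compact_open_subgroupD[OF V]
  define F where "F S = (S <#> S) \<union> (\<lambda>x. inv x) ` S \<union> \<alpha> ` S \<union> aut_inv G \<alpha> ` S" for S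
  define K where "K n = (F ^^ n) V" for n
  define H where "H = (\<Union>n. K n)"
  have K_Suc: "K (Suc n) = F (K n)" for n
    by (simp add: K_def)
  have KG: "K n \<subseteq> carrier G" for n
  proof (induction n)
    case 0
    then show ?case using VD(5) by (simp add: K_def)
  next
    case (Suc n)
    then show ?case using set_mult_closed[of "K n" "K n"] by (auto simp: K_Suc F_def)
  qed
  \<comment> \<open>The identity in \<open>K n\<close> makes the stages increase, so two elements of
    the union can be multiplied in a common stage.\<close>
  have one_step: "K n \<subseteq> K (Suc n)" if "\<one> \<in> K n" for n
    using that KG r_one unfolding K_Suc F_def set_mult_def by (force simp: subset_iff)
  have "\<one> \<in> K n" for n
  proof (induction n)
    case 0
    then show ?case using subgroup.one_closed[OF VD(1)] by (simp add: K_def)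
  qed (use one_step in blast)
  then have "incseq K"
    using one_step by (intro incseq_SucI) blast
  have K_compact: "compactin T (K n)" for n
  proof (induction n)
    case 0
    then show ?case using VD(2) by (simp add: K_def)
  next
    case (Suc n)
    have "compactin T ((\<lambda>(x, y). x \<otimes> y) ` (K n \<times> K n))"
      using Suc continuous_mult by (intro image_compactin) (auto simp: compactin_Times)
    moreover have "(\<lambda>(x, y). x \<otimes> y) ` (K n \<times> K n) = K n <#> K n"
      by (auto simp: set_mult_def)
    ultimately show ?case
      unfolding K_Suc F_def
      using Suc by (intro compactin_Un) (auto intro: image_compactin continuous_inv continuous_aut continuous_aut_inv)
  qed
  have HG: "H \<subseteq> carrier G"
    using KG by (auto simp: H_def)
  have closed: "inv x \<in> H" "\<alpha> x \<in> H" "aut_inv G \<alpha> x \<in> H" if x: "x \<in> H" for x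
  proof -
    obtain n where "x \<in> K n"
      using x by (auto simp: H_def)
    then have "inv x \<in> K (Suc n)" "\<alpha> x \<in> K (Suc n)" "aut_inv G \<alpha> x \<in> K (Suc n)"
      by (auto simp: K_Suc F_def)
    then show "inv x \<in> H" "\<alpha> x \<in> H" "aut_inv G \<alpha> x \<in> H"
      unfolding H_def by blast+
  qed
  have "subgroup H G"
  proof
    fix x y assume "x \<in> H" "y \<in> H"
    then obtain m n where "x \<in> K m" "y \<in> K n"
      by (auto simp: H_def)
    then have "x \<in> K (max m n)" "y \<in> K (max m n)"
      using \<open>incseq K\<close> by (meson incseqD max.cobounded1 max.cobounded2 subsetD)+
    then have "x \<otimes> y \<in> K (Suc (max m n))"
      unfolding K_Suc F_def set_mult_def by blast
    then show "x \<otimes> y \<in> H"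
      unfolding H_def by blast
  qed (use HG closed \<open>\<And>n. \<one> \<in> K n\<close> in \<open>auto simp: H_def\<close>)
  moreover have "\<alpha> ` H = H"
    using closed HG by (force intro: rev_image_eqI[of "aut_inv G \<alpha> _"])
  moreover have "sigma_compactin T H"
    unfolding sigma_compactin_def H_def using K_compact by blast
  moreover have "V \<subseteq> H"
    unfolding H_def by (rule order_trans[OF _ UN_upper[of 0]]) (auto simp: K_def)
  then have "openin T H"
    using openin_subgroup_of_nhd[OF \<open>subgroup H G\<close> VD(3)] subgroup.one_closed[OF VD(1)] by blast
  ultimately show ?thesis
    by blast
qed

end

section \<open>Restriction to stable subgroups\<close>

lemma (in topological_group) topological_group_subgroup:
  assumes H: "subgroup H G"
  shows "topological_group (G\<lparr>carrier := H\<rparr>) (subtopology T H)"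
proof (intro topological_group.intro topological_group_axioms.intro)
  have HG: "H \<subseteq> carrier G"
    using subgroup.subset[OF H] .
  show "Group.group (G\<lparr>carrier := H\<rparr>)"
    using H by (rule subgroup_imp_group)
  show "topspace (subtopology T H) = carrier (G\<lparr>carrier := H\<rparr>)"
    using HG by (auto simp: topspace_eq_carrier)
  have "continuous_map (subtopology (prod_topology T T) (H \<times> H)) T (\<lambda>(x, y). x \<otimes> y)"
    using continuous_mult by (rule continuous_map_from_subtopology)
  then show "continuous_map (prod_topology (subtopology T H) (subtopology T H)) (subtopology T H)
      (\<lambda>(x, y). x \<otimes>\<^bsub>G\<lparr>carrier := H\<rparr>\<^esub> y)"
    using subgroup.m_closed[OF H] by (auto simp: continuous_map_in_subtopology subtopology_Times)
  have "continuous_map (subtopology T H) (subtopology T H) (\<lambda>x. inv x)"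
    using continuous_inv subgroup.m_inv_closed[OF H]
    by (auto simp: continuous_map_in_subtopology intro: continuous_map_from_subtopology)
  then show "continuous_map (subtopology T H) (subtopology T H) (\<lambda>x. inv\<^bsub>G\<lparr>carrier := H\<rparr>\<^esub> x)"
    using H by (auto intro: continuous_map_eq)
  show "Hausdorff_space (subtopology T H)"
    using Hausdorff by (rule Hausdorff_space_subtopology)
qed

context topological_automorphism
begin

context
  fixes H
  assumes H: "subgroup H G" and stable: "\<alpha> ` H = H"
begin

lemma inj_on_stable_subgroup: "inj_on \<alpha> H"
  using bij_betw_aut subgroup.subset[OF H] by (meson bij_betw_def inj_on_subset)

lemma aut_inv_restrict:
  assumes "x \<in> H"
  shows "aut_inv (G\<lparr>carrier := H\<rparr>) (restrict \<alpha> H) x = aut_inv G \<alpha> x" "aut_inv G \<alpha> x \<in> H"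
proof -
  obtain y where y: "y \<in> H" "x = \<alpha> y"
    using assms stable by blast
  have "inj_on (restrict \<alpha> H) H"
    using inj_on_stable_subgroup by (simp add: inj_on_def)
  then have "inv_into H (restrict \<alpha> H) x = y"
    using y inv_into_f_f[of "restrict \<alpha> H" H y] by simp
  moreover have "aut_inv G \<alpha> x = y"
    using y subgroup.mem_carrier[OF H] by simp
  ultimately show "aut_inv (G\<lparr>carrier := H\<rparr>) (restrict \<alpha> H) x = aut_inv G \<alpha> x" "aut_inv G \<alpha> x \<in> H"
    using y by (simp_all add: aut_inv_def)
qed

lemma aut_pow_restrict:
  assumes "x \<in> H"
  shows "aut_pow (G\<lparr>carrier := H\<rparr>) (restrict \<alpha> H) n x = aut_pow G \<alpha> n x"
proof -
  \<comment> \<open>The second conjunct keeps the iterates in \<open>H\<close>, where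
    \<open>restrict\<close> agrees with \<open>\<alpha>\<close>.\<close>
  have "(restrict \<alpha> H ^^ k) x = (\<alpha> ^^ k) x \<and> (\<alpha> ^^ k) x \<in> H" for k
    using assms stable by (induction k) auto
  moreover have "(aut_inv (G\<lparr>carrier := H\<rparr>) (restrict \<alpha> H) ^^ k) x = (aut_inv G \<alpha> ^^ k) x \<and>
      (aut_inv G \<alpha> ^^ k) x \<in> H" for k
    using assms by (induction k) (auto simp: aut_inv_restrict)
  ultimately show ?thesis
    by (simp add: aut_pow_def)
qed

lemma topological_automorphism_restrict:
  "topological_automorphism (G\<lparr>carrier := H\<rparr>) (subtopology T H) (restrict \<alpha> H)"
proof (intro topological_automorphism.intro topological_automorphism_axioms.intro)
  show "topological_group (G\<lparr>carrier := H\<rparr>) (subtopology T H)"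
    using H by (rule topological_group_subgroup)
  have "bij_betw (restrict \<alpha> H) H H"
    using inj_on_stable_subgroup stable by (auto simp: bij_betw_def inj_on_def)
  moreover have "restrict \<alpha> H \<in> hom (G\<lparr>carrier := H\<rparr>) (G\<lparr>carrier := H\<rparr>)"
    using aut_pow_mult[of _ _ 1] stable subgroup.mem_carrier[OF H] subgroup.m_closed[OF H]
    by (auto simp: hom_def)
  ultimately show "restrict \<alpha> H \<in> iso (G\<lparr>carrier := H\<rparr>) (G\<lparr>carrier := H\<rparr>)"
    by (simp add: iso_def)
  have "continuous_map (subtopology T H) (subtopology T H) \<alpha>"
    using continuous_aut stable by (auto simp: continuous_map_in_subtopology intro: continuous_map_from_subtopology)
  then show "continuous_map (subtopology T H) (subtopology T H) (restrict \<alpha> H)"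
    by (rule continuous_map_eq) auto
  have "continuous_map (subtopology T H) (subtopology T H) (aut_inv G \<alpha>)"
    using continuous_aut_inv aut_inv_restrict(2)
    by (auto simp: continuous_map_in_subtopology intro: continuous_map_from_subtopology)
  then show "continuous_map (subtopology T H) (subtopology T H)
      (aut_inv (G\<lparr>carrier := H\<rparr>) (restrict \<alpha> H))"
    by (rule continuous_map_eq) (simp add: aut_inv_restrict)
qed

end

end

text \<open>The trace on \<open>H\<close> of an open set \<open>W\<close> inside the expansive
  neighbourhood is again expansive: its translates all contain the identity and lie in those of the
  larger set.\<close>

lemma (in expansive_automorphism) expansive_automorphism_restrict:
  assumes H: "subgroup H G" and stable: "\<alpha> ` H = H"
  shows "expansive_automorphism (G\<lparr>carrier := H\<rparr>) (subtopology T H) (restrict \<alpha> H)"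
proof (intro expansive_automorphism.intro expansive_automorphism_axioms.intro)
  show "topological_automorphism (G\<lparr>carrier := H\<rparr>) (subtopology T H) (restrict \<alpha> H)"
    using assms by (rule topological_automorphism_restrict)
  obtain U W where U: "(\<Inter>n::int. aut_pow G \<alpha> n ` U) = {\<one>}"
    and W: "openin T W" "\<one> \<in> W" "W \<subseteq> U"
    using expansive by (auto simp: identity_nhd_def)
  have one: "\<one> \<in> W \<inter> H"
    using W(2) subgroup.one_closed[OF H] by simp
  have "aut_pow (G\<lparr>carrier := H\<rparr>) (restrict \<alpha> H) n ` (W \<inter> H) = aut_pow G \<alpha> n ` (W \<inter> H)" for n
    by (intro image_cong) (auto simp: aut_pow_restrict[OF assms])
  moreover have "\<one> \<in> (\<Inter>n. aut_pow G \<alpha> n ` (W \<inter> H))"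
    using one by (metis aut_pow_one imageI INT_I)
  moreover have "(\<Inter>n. aut_pow G \<alpha> n ` (W \<inter> H)) \<subseteq> (\<Inter>n. aut_pow G \<alpha> n ` U)"
    using W(3) by (intro INT_anti_mono image_mono) auto
  ultimately have "(\<Inter>n::int. aut_pow (G\<lparr>carrier := H\<rparr>) (restrict \<alpha> H) n ` (W \<inter> H)) = {\<one>}"
    using U by auto
  moreover have "identity_nhd (G\<lparr>carrier := H\<rparr>) (subtopology T H) (W \<inter> H)"
    using W(1) one by (auto simp: identity_nhd_def openin_subtopology)
  ultimately show "\<exists>U. identity_nhd (G\<lparr>carrier := H\<rparr>) (subtopology T H) U \<and>
      (\<Inter>n. aut_pow (G\<lparr>carrier := H\<rparr>) (restrict \<alpha> H) n ` U) = {\<one>\<^bsub>G\<lparr>carrier := H\<rparr>\<^esub>}"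
    by auto
qed

section \<open>Choice of a factorizing subgroup with trivial \<open>V_zero\<close>\<close>

theorem lemma1p1:
  fixes G :: "('a, 'b) monoid_scheme" and T :: "'a topology" and \<alpha> :: "'a \<Rightarrow> 'a"
  assumes "tdlc_group G T" and "expansive_automorphism G T \<alpha>"
  shows
    "(metrizable_space T \<and>
      (\<exists>H. subgroup H G \<and> \<alpha> ` H = H \<and> sigma_compactin T H \<and> openin T H)) \<and>
     (\<forall>V. compact_open_subgroup G T V \<and> V_zero G \<alpha> V = {\<one>\<^bsub>G\<^esub>} \<longrightarrow>
       V_minusminus G \<alpha> V = contraction_group G T \<alpha> \<and>
       V_plusplus G \<alpha> V = contraction_group G T (aut_inv G \<alpha>)) \<and>
     (\<exists>V. compact_open_subgroup G T V \<and>
       V = V_plus G \<alpha> V <#>\<^bsub>G\<^esub> V_minus G \<alpha> V \<and> V_zero G \<alpha> V = {\<one>\<^bsub>G\<^esub>}) \<and>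
     openin T (contraction_group G T \<alpha> <#>\<^bsub>G\<^esub> contraction_group G T (aut_inv G \<alpha>)) \<and>
     (\<forall>H. subgroup H G \<and> \<alpha> ` H = H \<longrightarrow>
       expansive_automorphism (G\<lparr>carrier := H\<rparr>) (subtopology T H) (restrict \<alpha> H))"
proof -
  interpret tdlc_group G T by fact
  interpret expansive_automorphism G T \<alpha> by fact
  obtain U W where U: "(\<Inter>n::int. aut_pow G \<alpha> n ` U) = {\<one>\<^bsub>G\<^esub>}"
    and W: "openin T W" "\<one>\<^bsub>G\<^esub> \<in> W" "W \<subseteq> U"
    using expansive by (auto simp: identity_nhd_def)
  obtain V' where V': "compact_open_subgroup G T V'" "V' \<subseteq> W"
    using van_Dantzig W by blast
  obtain V where V: "compact_open_subgroup G T V" "V \<subseteq> V'" "V = V_plus G \<alpha> V <#>\<^bsub>G\<^esub> V_minus G \<alpha> V"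
    using tidy_subgroup V'(1) by blast
  \<comment> \<open>Shrinking from \<open>U\<close> through \<open>W\<close> and \<open>V'\<close>
    to \<open>V\<close> only shrinks the intersection of translates, so the factorizing subgroup
    inherits a trivial \<open>V_zero\<close>.\<close>
  have "V_zero G \<alpha> V \<subseteq> (\<Inter>n::int. aut_pow G \<alpha> n ` U)"
    unfolding V_zero_eq using V(2) V'(2) W(3) by blast
  moreover have "\<one>\<^bsub>G\<^esub> \<in> V_zero G \<alpha> V"
    using compact_open_subgroupD[OF V(1)] subgroup.one_closed[OF subgroup_orbit_window]
    by (simp add: V_zero_eq_orbit_window)
  ultimately have V0: "V_zero G \<alpha> V = {\<one>\<^bsub>G\<^esub>}"
    using U by blast
  show ?thesis
  proof (intro conjI allI impI)
    show "metrizable_space T"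
      using V(1) V0 by (rule metrizable_of_trivial_V_zero)
    show "\<exists>H. subgroup H G \<and> \<alpha> ` H = H \<and> sigma_compactin T H \<and> openin T H"
      using V(1) by (rule stable_sigma_compact_open_subgroup)
    \<comment> \<open>Here \<open>V\<close> is arbitrary with trivial \<open>V_zero\<close> and
      shadows the subgroup fixed above.\<close>
    show "V_minusminus G \<alpha> V = contraction_group G T \<alpha>"
      "V_plusplus G \<alpha> V = contraction_group G T (aut_inv G \<alpha>)"
      if "compact_open_subgroup G T V \<and> V_zero G \<alpha> V = {\<one>\<^bsub>G\<^esub>}" for V
      using that V_minusminus_eq_contraction_group V_plusplus_eq_contraction_group by auto
    show "\<exists>V. compact_open_subgroup G T V \<and>
        V = V_plus G \<alpha> V <#>\<^bsub>G\<^esub> V_minus G \<alpha> V \<and> V_zero G \<alpha> V = {\<one>\<^bsub>G\<^esub>}"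
      using V(1,3) V0 by (intro exI conjI)
    show "openin T (contraction_group G T \<alpha> <#>\<^bsub>G\<^esub> contraction_group G T (aut_inv G \<alpha>))"
      using V(1,3) V0 by (rule openin_contraction_group_mult)
    show "expansive_automorphism (G\<lparr>carrier := H\<rparr>) (subtopology T H) (restrict \<alpha> H)"
      if "subgroup H G \<and> \<alpha> ` H = H" for H
      using that expansive_automorphism_restrict by blast
  qed
qed

end
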